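(* Let $a\in\mathbb{R}$, $0<\nu<1$, $p:\mathbb{N}_{a+1}\to(0,\infty)$, $q:\mathbb{N}_{a+1}\to\mathbb{R}$, and let $(L_ay)(t)=\nabla[p(t+1)\nabla_{a*}^{\nu}y(t+1)]+q(t)y(t)$ for $y:\mathbb{N}_a\to\mathbb{R}$, $t\in\mathbb{N}_{a+1}$. Let $h:\mathbb{N}_{a+1}\to\mathbb{R}$ and let $A,B\in\mathbb{R}$ be arbitrary constants. Then the solution $y:\mathbb{N}_a\to\mathbb{R}$ of the initial value problem $$L_ay(t)=h(t)\ \ (t\in\mathbb{N}_{a+1}),\qquad y(a)=A,\qquad \nabla y(a+1)=B,$$ is given by $$y(t)=y_0(t)+\int_a^t x(t,s)h(s)\,\nabla s,$$ where $x(t,s)$ is the Cauchy function for $L_a$ and $y_0:\mathbb{N}_a\to\mathbb{R}$ solves the initial value problem $$L_ay_0(t)=0\ \ (t\in\mathbb{N}_{a+1}),\qquad y_0(a)=A,\qquad \nabla y_0(a+1)=B.$$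
   Context: For $a\in\mathbb{R}$, $\mathbb{N}_a=\{a,a+1,a+2,\dots\}$. The nabla difference is $\nabla f(t)=f(t)-f(t-1)$ (for functions of $(t,s)$ it acts in $t$). The definite nabla integral is $\int_c^d f(s)\nabla s=\sum_{s=c+1}^d f(s)$ if $c<d$, and $0$ if $d\le c$. The generalized rising function is $t^{\overline{\mu}}=\Gamma(t+\mu)/\Gamma(t)$, with the convention $t^{\overline{\mu}}=0$ if $t$ is a non-positive integer and $t+\mu$ is not a non-positive integer. For $\mu>0$, the nabla fractional sum based at $a$ is $\nabla_a^{-\mu}f(t)=\sum_{s=a+1}^t\frac{(t-s+1)^{\overline{\mu-1}}}{\Gamma(\mu)}f(s)$ for $t\in\mathbb{N}_a$ (empty sums are $0$). For $0<\nu<1$ the Caputo nabla fractional difference based at $a$ is $\nabla_{a*}^{\nu}x(t)=\nabla_a^{-(1-\nu)}(\nabla x)(t)=\sum_{\tau=a+1}^{t}\frac{(t-\tau+1)^{\overline{-\nu}}}{\Gamma(1-\nu)}\nabla x(\tau)$ for $t\in\mathbb{N}_a$; $\nabla_{a*}^{\nu}x(t+1)$ denotes its value at $t+1$. In $L_a$ the outer $\nabla$ acts in $t$, so $\nabla[p(t+1)\nabla_{a*}^{\nu}x(t+1)]=p(t+1)\nabla_{a*}^{\nu}x(t+1)-p(t)\nabla_{a*}^{\nu}x(t)$. For $s\in\mathbb{N}_a$, $L_s$ denotes the same operator with base point $a$ replaced by $s$: $(L_sx)(t)=\nabla[p(t+1)\nabla_{s*}^{\nu}x(t+1)]+q(t)x(t)$,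 $t\in\mathbb{N}_{s+1}$, for $x:\mathbb{N}_s\to\mathbb{R}$. The Cauchy function for $L_a$ is the function $x(t,s)$ ($s\in\mathbb{N}_a$, $t\in\mathbb{N}_s$) such that, for each fixed $s\in\mathbb{N}_a$, $x(\cdot,s)$ solves the initial value problem $L_sx(t,s)=0$ for $t\in\mathbb{N}_{s+1}$, $x(s,s)=0$, $\nabla x(s+1,s)=\frac{1}{p(s+1)}$. *)

theory Defs
  imports "HOL-Analysis.Analysis"
begin

text \<open>
  Functions on a grid \<open>a, a + 1, a + 2, \<dots>\<close> are represented by total functions on the reals;
  every condition below only refers to their values on the grid, so values elsewhere
  are irrelevant.
\<close>

definition grid :: "real \<Rightarrow> real set" where
  "grid a = {a + real n | n. True}"

definition nabla :: "(real \<Rightarrow> real) \<Rightarrow> real \<Rightarrow> real" where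
  "nabla f t = f t - f (t - 1)"

definition nabla_integral :: "real \<Rightarrow> real \<Rightarrow> (real \<Rightarrow> real) \<Rightarrow> real" where
  "nabla_integral c d f = (if c < d then \<Sum>s | s \<in> grid (c + 1) \<and> s \<le> d. f s else 0)"

text \<open>
  If both \<open>t\<close> and \<open>t + \<mu>\<close> are non-positive integers, the value is \<open>0 / 0 = 0\<close>;
  this case is never used, since below \<open>t \<ge> 1\<close> throughout.
\<close>

definition rising :: "real \<Rightarrow> real \<Rightarrow> real" where
  "rising t \<mu> =
     (if t \<in> \<int>\<^sub>\<le>\<^sub>0 \<and> t + \<mu> \<notin> \<int>\<^sub>\<le>\<^sub>0 then 0 else Gamma (t + \<mu>) / Gamma t)"

definition nabla_frac_sum :: "real \<Rightarrow> real \<Rightarrow> (real \<Rightarrow> real) \<Rightarrow> real \<Rightarrow> real" where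
  "nabla_frac_sum \<mu> a f t =
     (\<Sum>s | s \<in> grid (a + 1) \<and> s \<le> t. rising (t - s + 1) (\<mu> - 1) / Gamma \<mu> * f s)"

text \<open>The Caputo difference, for order \<open>0 < \<nu> < 1\<close>.\<close>

definition caputo_nabla :: "real \<Rightarrow> real \<Rightarrow> (real \<Rightarrow> real) \<Rightarrow> real \<Rightarrow> real" where
  "caputo_nabla \<nu> a x t = nabla_frac_sum (1 - \<nu>) a (nabla x) t"

definition L_op ::
  "real \<Rightarrow> (real \<Rightarrow> real) \<Rightarrow> (real \<Rightarrow> real) \<Rightarrow> real \<Rightarrow> (real \<Rightarrow> real) \<Rightarrow> real \<Rightarrow> real" where
  "L_op \<nu> p q a x t = nabla (\<lambda>u. p (u + 1) * caputo_nabla \<nu> a x (u + 1)) t + q t * x t"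

definition solves_ivp ::
  "real \<Rightarrow> (real \<Rightarrow> real) \<Rightarrow> (real \<Rightarrow> real) \<Rightarrow> real \<Rightarrow> (real \<Rightarrow> real) \<Rightarrow> real \<Rightarrow> real
     \<Rightarrow> (real \<Rightarrow> real) \<Rightarrow> bool" where
  "solves_ivp \<nu> p q a h A B y \<longleftrightarrow>
     (\<forall>t\<in>grid (a + 1). L_op \<nu> p q a y t = h t) \<and> y a = A \<and> nabla y (a + 1) = B"

text \<open>The base point of the operator is \<open>s\<close>, not \<open>a\<close>.\<close>

definition cauchy_function ::
  "real \<Rightarrow> (real \<Rightarrow> real) \<Rightarrow> (real \<Rightarrow> real) \<Rightarrow> real \<Rightarrow> (real \<Rightarrow> real \<Rightarrow> real) \<Rightarrow> bool" where
  "cauchy_function \<nu> p q a x \<longleftrightarrow>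
     (\<forall>s\<in>grid a. solves_ivp \<nu> p q s (\<lambda>_. 0) 0 (1 / p (s + 1)) (\<lambda>t. x t s))"

end

theory Submission
  imports Defs
begin

text \<open>
  Since \<open>x(s,s) = 0\<close>, the Caputo difference passes through the variation of constants sum
  \<open>z(t) = \<Sum>\<^sub>s x(t,s) h(s)\<close> and becomes \<open>\<Sum>\<^sub>s h(s) \<nabla>\<^sub>s\<^sub>*\<^sup>\<nu> x(t,s)\<close>, the base point moving from
  \<open>a\<close> to \<open>s\<close> because only \<open>\<tau> > s\<close> contributes. Hence \<open>L\<^sub>a z(t)\<close> is the sum of
  \<open>h(s) L\<^sub>s x(t,s) = 0\<close> over \<open>s < t\<close> plus the boundary term
  \<open>h(t) p(t+1) \<nabla>x(t+1,t) = h(t)\<close>. Solutions are unique because \<open>p > 0\<close> and the kernel of the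
  Caputo difference is \<open>1\<close> on the diagonal.
\<close>

text \<open>The weight in the Caputo sum depends only on the lag between two grid points, hence the
  natural number index.\<close>

definition caputo_kernel :: "real \<Rightarrow> nat \<Rightarrow> real" where
  "caputo_kernel \<nu> k = rising (real k + 1) (- \<nu>) / Gamma (1 - \<nu>)"

lemma caputo_kernel_0:
  assumes "\<nu> < 1"
  shows "caputo_kernel \<nu> 0 = 1"
proof -
  have "Gamma (1 - \<nu>) > 0" using assms by (intro Gamma_real_pos) simp
  moreover have "(1::real) \<notin> \<int>\<^sub>\<le>\<^sub>0" by simp
  ultimately show ?thesis by (simp add: caputo_kernel_def rising_def)
qed

lemma grid_iff: "t \<in> grid a \<longleftrightarrow> (\<exists>n. t = a + real n)"
  by (auto simp: grid_def)

lemma ball_grid: "(\<forall>t\<in>grid a. P t) \<longleftrightarrow> (\<forall>n. P (a + real n))"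
  by (auto simp: grid_def)

lemma ball_grid_Suc: "(\<forall>t\<in>grid (a + 1). P t) \<longleftrightarrow> (\<forall>n. P (a + real (Suc n)))"
  by (simp add: ball_grid add_ac)

text \<open>The base \<open>a + real j\<close> is kept apart from the origin \<open>a\<close>, so
  that sums for operators with different base points are all indexed from \<open>a\<close>.\<close>

lemma sum_grid:
  "(\<Sum>s | s \<in> grid (a + real j + 1) \<and> s \<le> a + real n. f s) = (\<Sum>k\<in>{j<..n}. f (a + real k))"
proof -
  have "{s. s \<in> grid (a + real j + 1) \<and> s \<le> a + real n} = (\<lambda>k. a + real k) ` {j<..n}"
  proof (intro equalityI subsetI)
    fix s assume "s \<in> {s. s \<in> grid (a + real j + 1) \<and> s \<le> a + real n}"
    then obtain i where "s = a + real (j + 1 + i)" "s \<le> a + real n"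
      by (auto simp: grid_iff add_ac)
    then show "s \<in> (\<lambda>k. a + real k) ` {j<..n}"
      by (intro image_eqI[of _ _ "j + 1 + i"]) auto
  next
    fix s assume "s \<in> (\<lambda>k. a + real k) ` {j<..n}"
    then obtain k where k: "s = a + real k" "j < k" "k \<le> n" by auto
    then have "s = a + real j + 1 + real (k - Suc j)"
      by (simp add: of_nat_diff)
    then have "s \<in> grid (a + real j + 1)" unfolding grid_iff by blast
    with k show "s \<in> {s. s \<in> grid (a + real j + 1) \<and> s \<le> a + real n}" by simp
  qed
  moreover have "inj_on (\<lambda>k. a + real k) {j<..n}" by (simp add: inj_on_def)
  ultimately show ?thesis by (simp add: sum.reindex)
qed

lemma nabla_integral_grid:
  "nabla_integral a (a + real n) f = (\<Sum>k\<in>{0<..n}. f (a + real k))"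
  using sum_grid[where j = 0 and a = a and n = n and f = f] by (cases "n = 0") (auto simp: nabla_integral_def)

lemma caputo_nabla_grid:
  "caputo_nabla \<nu> (a + real j) x (a + real n) =
     (\<Sum>k\<in>{j<..n}. caputo_kernel \<nu> (n - k) * nabla x (a + real k))"
  unfolding caputo_nabla_def nabla_frac_sum_def sum_grid caputo_kernel_def
  by (intro sum.cong) (auto simp: of_nat_diff)

lemma caputo_nabla_grid_0:
  "caputo_nabla \<nu> a x (a + real n) =
     (\<Sum>k\<in>{0<..n}. caputo_kernel \<nu> (n - k) * nabla x (a + real k))"
  using caputo_nabla_grid[where j = 0] by simp

text \<open>Points stay in the form \<open>a + real k\<close> with \<open>real (Suc n)\<close>
  folded, so that the grid lemmas keep matching; hence the recurring
  \<open>del: of_nat_Suc\<close>.\<close>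

lemma nabla_grid_Suc: "nabla f (a + real (Suc n)) = f (a + real (Suc n)) - f (a + real n)"
proof -
  have "a + real (Suc n) - 1 = a + real n" by simp
  then show ?thesis by (simp only: nabla_def)
qed

text \<open>At \<open>k = 0\<close> the difference would read the off-grid point
  \<open>a - 1\<close>.\<close>

lemma nabla_grid_cong:
  assumes "\<And>i. i \<le> k \<Longrightarrow> x (a + real i) = y (a + real i)" and "0 < k"
  shows "nabla x (a + real k) = nabla y (a + real k)"
proof -
  obtain i where "k = Suc i" using assms(2) gr0_implies_Suc by blast
  then show ?thesis using assms(1)[of k] assms(1)[of i] by (simp only: nabla_grid_Suc)
qed

lemma caputo_nabla_cong:
  assumes "\<And>i. i \<le> n \<Longrightarrow> x (a + real i) = y (a + real i)"
  shows "caputo_nabla \<nu> a x (a + real n) = caputo_nabla \<nu> a y (a + real n)"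
  unfolding caputo_nabla_grid_0
  using assms by (intro sum.cong refl arg_cong2[of _ _ _ _ "(*)"] nabla_grid_cong) auto

lemma caputo_nabla_add:
  "caputo_nabla \<nu> a (\<lambda>t. x t + y t) u = caputo_nabla \<nu> a x u + caputo_nabla \<nu> a y u"
  by (simp add: caputo_nabla_def nabla_frac_sum_def nabla_def algebra_simps
      add_divide_distrib diff_divide_distrib flip: sum.distrib)

text \<open>Exhibits the operator as a recursion: the latest point it reads is
  \<open>a + real (Suc (Suc n))\<close>, and only through the first Caputo term.\<close>

lemma L_op_grid_Suc:
  "L_op \<nu> p q b x (a + real (Suc n)) =
     p (a + real (Suc (Suc n))) * caputo_nabla \<nu> b x (a + real (Suc (Suc n)))
     - p (a + real (Suc n)) * caputo_nabla \<nu> b x (a + real (Suc n))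
     + q (a + real (Suc n)) * x (a + real (Suc n))"
proof -
  have "a + real (Suc n) + 1 = a + real (Suc (Suc n))"
    and "a + real (Suc n) - 1 + 1 = a + real (Suc n)" by simp_all
  then show ?thesis by (simp only: L_op_def nabla_def)
qed

lemma L_op_cong:
  assumes "\<And>i. x (a + real i) = y (a + real i)"
  shows "L_op \<nu> p q a x (a + real (Suc n)) = L_op \<nu> p q a y (a + real (Suc n))"
  using caputo_nabla_cong[of _ x a y \<nu>] assms by (simp add: L_op_grid_Suc del: of_nat_Suc)

lemma L_op_add:
  "L_op \<nu> p q a (\<lambda>t. x t + y t) t = L_op \<nu> p q a x t + L_op \<nu> p q a y t"
  by (simp add: L_op_def nabla_def caputo_nabla_add algebra_simps)

lemma solves_ivp_grid:
  "solves_ivp \<nu> p q a h A B y \<longleftrightarrow>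
     (\<forall>n. L_op \<nu> p q a y (a + real (Suc n)) = h (a + real (Suc n))) \<and>
     y a = A \<and> nabla y (a + 1) = B"
  unfolding solves_ivp_def ball_grid_Suc ..

lemma solves_ivp_cong:
  assumes "\<forall>t\<in>grid a. x t = y t"
  shows "solves_ivp \<nu> p q a h A B x \<longleftrightarrow> solves_ivp \<nu> p q a h A B y"
proof -
  have eq: "x (a + real i) = y (a + real i)" for i using assms by (simp add: ball_grid)
  then have "nabla x (a + 1) = nabla y (a + 1)" "x a = y a"
    using eq[of 0] eq[of 1] by (simp_all add: nabla_def)
  then show ?thesis using L_op_cong[of x a y, OF eq] by (simp add: solves_ivp_grid del: of_nat_Suc)
qed

lemma solves_ivp_add:
  assumes "solves_ivp \<nu> p q a h A B x" and "solves_ivp \<nu> p q a g A' B' y"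
  shows "solves_ivp \<nu> p q a (\<lambda>t. h t + g t) (A + A') (B + B') (\<lambda>t. x t + y t)"
  using assms by (simp add: solves_ivp_def L_op_add) (auto simp: nabla_def)

text \<open>Strong induction: the initial data fix the first two values, and afterwards the equation
  determines each new value from the earlier ones.\<close>

lemma solves_ivp_unique:
  assumes "\<nu> < 1" and p: "\<forall>t\<in>grid (a + 1). p t \<noteq> 0"
    and x: "solves_ivp \<nu> p q a h A B x" and y: "solves_ivp \<nu> p q a h A B y"
  shows "\<forall>t\<in>grid a. x t = y t"
proof -
  have "x (a + real n) = y (a + real n)" for n
  proof (induction n rule: less_induct)
    case (less n)
    consider "n = 0" | "n = 1" | m where "n = Suc (Suc m)"
      by (metis One_nat_def not0_implies_Suc)
    then show ?case
    proof cases
      case 1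
      then show ?thesis using x y by (simp add: solves_ivp_def)
    next
      case 2
      then show ?thesis using x y by (auto simp: solves_ivp_def nabla_def)
    next
      case 3
      have eq: "x (a + real i) = y (a + real i)" if "i \<le> Suc m" for i
        using less that 3 by simp
      have "caputo_nabla \<nu> a x (a + real (Suc m)) = caputo_nabla \<nu> a y (a + real (Suc m))"
        by (intro caputo_nabla_cong eq)
      moreover have "L_op \<nu> p q a x (a + real (Suc m)) = L_op \<nu> p q a y (a + real (Suc m))"
        using x y by (simp add: solves_ivp_grid del: of_nat_Suc)
      moreover have "p (a + real n) \<noteq> 0"
        using p unfolding ball_grid_Suc 3 by blast
      ultimately have "caputo_nabla \<nu> a x (a + real n) = caputo_nabla \<nu> a y (a + real n)"
        using eq[of "Suc m"] by (simp add: L_op_grid_Suc 3 del: of_nat_Suc)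
      \<comment> \<open>Only the lag 0 term involves the new value, and its weight is 1; the
        remaining terms agree by induction.\<close>
      moreover have "{0<..n} = insert n {0<..Suc m}" using 3 by auto
      then have split: "caputo_nabla \<nu> a f (a + real n) = nabla f (a + real n)
          + (\<Sum>k\<in>{0<..Suc m}. caputo_kernel \<nu> (n - k) * nabla f (a + real k))" for f
        using 3 \<open>\<nu> < 1\<close> by (simp add: caputo_nabla_grid_0 caputo_kernel_0 del: of_nat_Suc)
      moreover have "(\<Sum>k\<in>{0<..Suc m}. caputo_kernel \<nu> (n - k) * nabla x (a + real k))
          = (\<Sum>k\<in>{0<..Suc m}. caputo_kernel \<nu> (n - k) * nabla y (a + real k))"
        by (intro sum.cong refl arg_cong2[of _ _ _ _ "(*)"] nabla_grid_cong eq) auto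
      ultimately have "nabla x (a + real n) = nabla y (a + real n)" by simp
      then show ?thesis using eq[of "Suc m"] by (simp add: 3 nabla_grid_Suc del: of_nat_Suc)
    qed
  qed
  then show ?thesis by (simp add: ball_grid)
qed

text \<open>Raising the upper limit of the integral adds only the term \<open>x t t * h t\<close>,
  which is 0; hence the strict bound on \<open>j\<close>.\<close>

lemma nabla_variation_of_constants:
  fixes x :: "real \<Rightarrow> real \<Rightarrow> real"
  assumes diag: "\<And>j. x (a + real j) (a + real j) = 0" and "0 < k"
  shows "nabla (\<lambda>t. nabla_integral a t (\<lambda>s. x t s * h s)) (a + real k) =
    (\<Sum>j\<in>{0<..<k}. nabla (\<lambda>t. x t (a + real j)) (a + real k) * h (a + real j))"
proof -
  obtain i where k: "k = Suc i" using assms(2) gr0_implies_Suc by blast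
  have "{0<..Suc i} = insert (Suc i) {0<..i}" "{0<..<Suc i} = {0<..i}" by auto
  then show ?thesis
    unfolding k nabla_grid_Suc nabla_integral_grid
    by (simp add: diag left_diff_distrib sum_subtractf del: of_nat_Suc)
qed

lemma caputo_variation_of_constants:
  fixes x :: "real \<Rightarrow> real \<Rightarrow> real"
  assumes diag: "\<And>j. x (a + real j) (a + real j) = 0"
  shows "caputo_nabla \<nu> a (\<lambda>t. nabla_integral a t (\<lambda>s. x t s * h s)) (a + real n) =
    (\<Sum>j\<in>{0<..<n}. h (a + real j) *
       caputo_nabla \<nu> (a + real j) (\<lambda>t. x t (a + real j)) (a + real n))"
proof -
  define F where "F k j = caputo_kernel \<nu> (n - k)
    * (nabla (\<lambda>t. x t (a + real j)) (a + real k) * h (a + real j))" for k j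
  have "caputo_nabla \<nu> a (\<lambda>t. nabla_integral a t (\<lambda>s. x t s * h s)) (a + real n) =
      (\<Sum>k\<in>{0<..n}. \<Sum>j\<in>{0<..<k}. F k j)"
    by (simp add: caputo_nabla_grid_0 nabla_variation_of_constants[where x = x and a = a, OF diag]
        sum_distrib_left F_def)
  also have "\<dots> = (\<Sum>(k, j)\<in>(SIGMA k:{0<..n}. {0<..<k}). F k j)"
    by (simp add: sum.Sigma)
  \<comment> \<open>Exchange of summation over the triangle 0 < j < k \<le> n; the inner sum over
    \<open>k\<close> is then a Caputo difference based at \<open>a + real j\<close>.\<close>
  also have "\<dots> = (\<Sum>(j, k)\<in>(SIGMA j:{0<..<n}. {j<..n}). F k j)"
    by (intro sum.reindex_bij_witness[of _ prod.swap prod.swap]) auto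
  also have "\<dots> = (\<Sum>j\<in>{0<..<n}. \<Sum>k\<in>{j<..n}. F k j)"
    by (simp add: sum.Sigma)
  finally show ?thesis
    by (simp add: caputo_nabla_grid sum_distrib_left F_def mult_ac)
qed

lemma solves_ivp_variation_of_constants:
  assumes "\<nu> < 1" and p: "\<forall>t\<in>grid (a + 1). p t \<noteq> 0"
    and "cauchy_function \<nu> p q a x"
  shows "solves_ivp \<nu> p q a h 0 0 (\<lambda>t. nabla_integral a t (\<lambda>s. x t s * h s))"
proof -
  define z where "z = (\<lambda>t. nabla_integral a t (\<lambda>s. x t s * h s))"
  define C where "C j n = caputo_nabla \<nu> (a + real j) (\<lambda>t. x t (a + real j)) (a + real n)" for j n
  have sol: "solves_ivp \<nu> p q (a + real j) (\<lambda>_. 0) 0 (1 / p (a + real j + 1))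
      (\<lambda>t. x t (a + real j))" for j
    using assms(3) by (simp add: cauchy_function_def ball_grid)
  have diag: "x (a + real j) (a + real j) = 0" for j
    using sol[of j] by (simp add: solves_ivp_def)
  \<comment> \<open>One step after its base point the Caputo sum is the single difference
    1/p.\<close>
  have C_diag: "p (a + real (Suc j)) * C j (Suc j) = 1" for j
  proof -
    have "{j<..Suc j} = {Suc j}" by auto
    moreover have "nabla (\<lambda>t. x t (a + real j)) (a + real (Suc j)) = 1 / p (a + real (Suc j))"
      using sol[of j] by (simp add: solves_ivp_def add_ac)
    moreover have "p (a + real (Suc j)) \<noteq> 0" using p unfolding ball_grid_Suc by blast
    ultimately show ?thesis
      by (simp add: C_def caputo_nabla_grid caputo_kernel_0 \<open>\<nu> < 1\<close> del: of_nat_Suc)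
  qed
  have L0: "p (a + real (Suc (Suc n))) * C j (Suc (Suc n)) =
      p (a + real (Suc n)) * C j (Suc n) - q (a + real (Suc n)) * x (a + real (Suc n)) (a + real j)"
    if "j \<le> n" for j n
  proof -
    \<comment> \<open>The point is rewritten relative to the base \<open>a + real j\<close>;
      \<open>j \<le> n\<close> says exactly that the homogeneous equation is imposed there.\<close>
    have "a + real (Suc n) = a + real j + real (Suc (n - j))" using that by simp
    then have "L_op \<nu> p q (a + real j) (\<lambda>t. x t (a + real j)) (a + real (Suc n)) = 0"
      using sol[of j] unfolding solves_ivp_grid by metis
    then show ?thesis unfolding L_op_grid_Suc C_def by linarith
  qed
  have caputo_z: "caputo_nabla \<nu> a z (a + real n) = (\<Sum>j\<in>{0<..<n}. h (a + real j) * C j n)" for n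
    unfolding z_def C_def by (rule caputo_variation_of_constants[where x = x and a = a, OF diag])
  have z_grid: "z (a + real n) = (\<Sum>j\<in>{0<..n}. x (a + real n) (a + real j) * h (a + real j))" for n
    by (simp add: z_def nabla_integral_grid)
  have "L_op \<nu> p q a z (a + real (Suc n)) = h (a + real (Suc n))" for n
  proof -
    \<comment> \<open>The index \<open>Suc n\<close> split off by \<open>s1\<close> lies beyond the
      reach of \<open>L0\<close>; by \<open>C_diag\<close> it produces the right-hand side
      \<open>h\<close>.\<close>
    have s1: "{0<..<Suc (Suc n)} = insert (Suc n) {0<..n}" and s2: "{0<..<Suc n} = {0<..n}"
      and s3: "{0<..Suc n} = insert (Suc n) {0<..n}" by auto
    have "p (a + real (Suc (Suc n))) * caputo_nabla \<nu> a z (a + real (Suc (Suc n)))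
        = h (a + real (Suc n)) * (p (a + real (Suc (Suc n))) * C (Suc n) (Suc (Suc n)))
          + (\<Sum>j\<in>{0<..n}. h (a + real j) * (p (a + real (Suc (Suc n))) * C j (Suc (Suc n))))"
      unfolding caputo_z s1 by (simp add: algebra_simps sum_distrib_left del: of_nat_Suc)
    also have "(\<Sum>j\<in>{0<..n}. h (a + real j) * (p (a + real (Suc (Suc n))) * C j (Suc (Suc n))))
        = (\<Sum>j\<in>{0<..n}. h (a + real j) * (p (a + real (Suc n)) * C j (Suc n)
            - q (a + real (Suc n)) * x (a + real (Suc n)) (a + real j)))"
      by (intro sum.cong refl) (simp add: L0 del: of_nat_Suc)
    \<comment> \<open>The sum up to \<open>n\<close> is already \<open>z (a + real (Suc n))\<close>,
      whose top term vanishes on the diagonal.\<close>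
    also have "\<dots> = p (a + real (Suc n)) * caputo_nabla \<nu> a z (a + real (Suc n))
        - q (a + real (Suc n)) * z (a + real (Suc n))"
      unfolding caputo_z z_grid s2 s3
      by (simp add: diag right_diff_distrib sum_subtractf sum_distrib_left mult_ac del: of_nat_Suc)
    finally show ?thesis by (simp add: L_op_grid_Suc C_diag del: of_nat_Suc)
  qed
  moreover have "z a = 0" "nabla z (a + 1) = 0"
  proof -
    show "z a = 0" using z_grid[of 0] by simp
    \<comment> \<open>The only term of \<open>z (a + 1)\<close> is again a diagonal one.\<close>
    moreover have "{0<..Suc 0} = {Suc 0}" by auto
    then have "z (a + 1) = 0" using z_grid[of 1] diag[of 1] by simp
    ultimately show "nabla z (a + 1) = 0" by (simp add: nabla_def)
  qed
  ultimately show ?thesis unfolding z_def[symmetric] solves_ivp_grid by blast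
qed

theorem theorem21:
  fixes a \<nu> A B :: real
    and p q h y\<^sub>0 y :: "real \<Rightarrow> real"
    and x :: "real \<Rightarrow> real \<Rightarrow> real"
  assumes "0 < \<nu>" and "\<nu> < 1"
    and "\<forall>t\<in>grid (a + 1). 0 < p t"
    and "cauchy_function \<nu> p q a x"
    and "solves_ivp \<nu> p q a (\<lambda>_. 0) A B y\<^sub>0"
  shows "solves_ivp \<nu> p q a h A B y \<longleftrightarrow>
    (\<forall>t\<in>grid a. y t = y\<^sub>0 t + nabla_integral a t (\<lambda>s. x t s * h s))"
proof -
  have p: "\<forall>t\<in>grid (a + 1). p t \<noteq> 0" using assms(3) by force
  have sol: "solves_ivp \<nu> p q a h A B (\<lambda>t. y\<^sub>0 t + nabla_integral a t (\<lambda>s. x t s * h s))"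
    using solves_ivp_add[OF assms(5) solves_ivp_variation_of_constants[OF assms(2) p assms(4)]]
    by simp
  show ?thesis
  \<comment> \<open>Forward by uniqueness; backward because the initial value problem sees only
    values on the grid.\<close>
  proof
    assume "solves_ivp \<nu> p q a h A B y"
    then show "\<forall>t\<in>grid a. y t = y\<^sub>0 t + nabla_integral a t (\<lambda>s. x t s * h s)"
      using solves_ivp_unique[OF assms(2) p _ sol] by simp
  next
    assume "\<forall>t\<in>grid a. y t = y\<^sub>0 t + nabla_integral a t (\<lambda>s. x t s * h s)"
    from solves_ivp_cong[OF this] sol show "solves_ivp \<nu> p q a h A B y" by simp
  qed
qed

end
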